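(* Let $n\ge2$ and $N\ge1$. The map $\mathcal K_N:\Delta^N\to\mathfrak D(N,n)$, $\mathcal K_N(\lambda)=D^N_\lambda$, is a bijection.
   Context: Weights of $\mathfrak o_{2n}(\mathbb C)$ are written as $n$-tuples in the standard basis, with positive roots $h_i^*\pm h_j^*$ ($i<j$); $P_+$ is the set of dominant integral weights: $n$-tuples with all entries in $\mathbb Z$ or all in $\frac12+\mathbb Z$ and $\lambda_1\ge\dots\ge\lambda_{n-1}\ge|\lambda_n|$. $P[S]=\{(\pm\frac12,\dots,\pm\frac12)\}$ is the set of weights of the spinor representation $S$. $T^N$ is the set of $(\mu_1,\dots,\mu_N)\in P[S]^N$ with $\mu_1=(\frac12,\dots,\frac12,\pm\frac12)$ and $\sum_{i\le k}\mu_i\in P_+$ for all $k\le N$, and $\Delta^N=\{\sum_{i=1}^N\mu_i:(\mu_1,\dots,\mu_N)\in T^N\}$ (the set of highest weights of irreducible subrepresentations of $S^{\otimes N}$). A regular cell diagram $D(\mathbf l,\mathbf r)$ of length $N$ and height $n$ is determined by two $n$-tuples of non-negative integers $\mathbf l=(l_i)$, $\mathbf r=(r_i)$ with $r_i+l_i=N$ for all $i$, $r_1\ge r_2\ge\dots\ge r_n$ and $r_{n-1}\ge l_n$ (row $i$ has $r_i$ cells to the right and $l_i$ cells to the left of a vertical axis). $\mathfrak D(N,n)$ is the set of such diagrams. For $\lambda\in\Delta^N$, $D^N_\lambda=D(\mathbf l,\mathbf r)$ with $r_i=\frac N2+\lambda_i$ and $l_i=\frac N2-\lambda_i$. *)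

theory Defs
  imports Complex_Main
begin

text \<open>
  Weights of \<open>\<oo>\<^sub>2\<^sub>n(\<complex>)\<close> are lists of length \<open>n\<close> over the reals; the coordinate written
  \<open>\<lambda>\<^sub>i\<close> with \<open>1 \<le> i \<le> n\<close> is the list entry with index \<open>i - 1\<close>. Below \<open>n \<ge> 2\<close> is always intended.
\<close>

type_synonym weight = "real list"

definition dominant_weights :: "nat \<Rightarrow> weight set" where
  "dominant_weights n = {w. length w = n \<and>
     ((\<forall>i<n. w ! i \<in> \<int>) \<or> (\<forall>i<n. w ! i - 1/2 \<in> \<int>)) \<and>
     (\<forall>i. i + 2 < n \<longrightarrow> w ! i \<ge> w ! (i + 1)) \<and>
     w ! (n - 2) \<ge> \<bar>w ! (n - 1)\<bar>}"

definition spinor_weights :: "nat \<Rightarrow> weight set" where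
  "spinor_weights n = {\<mu>. length \<mu> = n \<and> (\<forall>i<n. \<mu> ! i = 1/2 \<or> \<mu> ! i = - 1/2)}"

definition partial_sum :: "nat \<Rightarrow> weight list \<Rightarrow> nat \<Rightarrow> weight" where
  "partial_sum n \<mu>s k = map (\<lambda>i. \<Sum>j<k. \<mu>s ! j ! i) [0..<n]"

definition spinor_paths :: "nat \<Rightarrow> nat \<Rightarrow> weight list set" where
  "spinor_paths n N = {\<mu>s. length \<mu>s = N \<and> set \<mu>s \<subseteq> spinor_weights n \<and>
     (\<mu>s ! 0 = replicate (n - 1) (1/2) @ [1/2] \<or> \<mu>s ! 0 = replicate (n - 1) (1/2) @ [- 1/2]) \<and>
     (\<forall>k\<in>{1..N}. partial_sum n \<mu>s k \<in> dominant_weights n)}"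

definition path_weights :: "nat \<Rightarrow> nat \<Rightarrow> weight set" where
  "path_weights n N = {partial_sum n \<mu>s N | \<mu>s. \<mu>s \<in> spinor_paths n N}"

text \<open>
  \<open>Diagram l r\<close> is \<open>D(l, r)\<close>. The row lengths have type \<open>real\<close> so that \<open>N/2 \<plusminus> \<lambda>\<^sub>i\<close> can be
  used without rounding or truncation; that they are natural numbers is part of the
  definition of \<open>regular_diagrams\<close>.
\<close>

datatype cell_diagram = Diagram (left_cells: "real list") (right_cells: "real list")

definition regular_diagrams :: "nat \<Rightarrow> nat \<Rightarrow> cell_diagram set" where
  "regular_diagrams N n = {Diagram l r | l r.
     length l = n \<and> length r = n \<and> set l \<subseteq> \<nat> \<and> set r \<subseteq> \<nat> \<and>
     (\<forall>i<n. r ! i + l ! i = real N) \<and>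
     (\<forall>i. i + 1 < n \<longrightarrow> r ! i \<ge> r ! (i + 1)) \<and>
     r ! (n - 2) \<ge> l ! (n - 1)}"

definition weight_diagram :: "nat \<Rightarrow> weight \<Rightarrow> cell_diagram" where
  "weight_diagram N w =
     Diagram (map (\<lambda>x. real N / 2 - x) w) (map (\<lambda>x. real N / 2 + x) w)"

end

theory Submission
  imports Defs
begin

text \<open>
  In the coordinates \<open>r\<^sub>i = N/2 + \<lambda>\<^sub>i\<close> a path adds at each step a cell to the right or to the left
  of the axis in every row, so \<open>r\<^sub>i\<close> counts the steps with entry \<open>+1/2\<close> in row \<open>i\<close>. Conversely, a
  regular diagram is reached by filling the right-hand cells of every row first: after \<open>k\<close> steps
  row \<open>i\<close> has \<open>min k r\<^sub>i\<close> cells on the right, which is monotone in \<open>i\<close>, and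
  \<open>min k r\<^sub>n\<^sub>-\<^sub>1 + min k r\<^sub>n \<ge> k\<close> because \<open>r\<^sub>n\<^sub>-\<^sub>1 + r\<^sub>n \<ge> N \<ge> k\<close>.
\<close>

text \<open>With \<open>l\<^sub>n = N - r\<^sub>n\<close> the last condition below is \<open>r\<^sub>n\<^sub>-\<^sub>1 \<ge> l\<^sub>n\<close>, moved to avoid subtraction.\<close>

definition regular_rows :: "nat \<Rightarrow> nat \<Rightarrow> nat list set" where
  "regular_rows N n = {r. length r = n \<and> set r \<subseteq> {..N} \<and> sorted (rev r) \<and>
     N \<le> r ! (n - 2) + r ! (n - 1)}"

definition rows_weight :: "nat \<Rightarrow> nat list \<Rightarrow> weight" where
  "rows_weight N r = map (\<lambda>m. real m - real N / 2) r"

definition rows_diagram :: "nat \<Rightarrow> nat list \<Rightarrow> cell_diagram" where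
  "rows_diagram N r = Diagram (map (\<lambda>m. real N - real m) r) (map real r)"

lemma sorted_rev_map_iff:
  assumes "\<And>x y. f x \<le> f y \<longleftrightarrow> x \<le> y"
  shows "sorted (rev (map f xs)) \<longleftrightarrow> sorted (rev xs)"
  by (simp add: rev_map sorted_map assms)

lemma weight_diagram_rows_weight: "weight_diagram N (rows_weight N r) = rows_diagram N r"
  by (simp add: weight_diagram_def rows_weight_def rows_diagram_def)

lemma inj_weight_diagram: "inj (weight_diagram N)"
  by (auto intro!: injI simp: weight_diagram_def inj_def dest: map_injective)

lemma regular_diagrams_iff:
  "Diagram l r \<in> regular_diagrams N n \<longleftrightarrow>
    length l = n \<and> length r = n \<and> set l \<subseteq> \<nat> \<and> set r \<subseteq> \<nat> \<and>
    (\<forall>i<n. r ! i + l ! i = real N) \<and> sorted (rev r) \<and> l ! (n - 1) \<le> r ! (n - 2)"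
  by (auto simp: regular_diagrams_def sorted_rev_iff_nth_Suc)

lemma rows_diagram_regular_iff:
  assumes "0 < n"
  shows "rows_diagram N r \<in> regular_diagrams N n \<longleftrightarrow> r \<in> regular_rows N n"
proof -
  have nat_diff: "real N - real m \<in> \<nat> \<longleftrightarrow> m \<le> N" for m
  proof
    show "m \<le> N" if "real N - real m \<in> \<nat>"
      using Nats_cases[OF that] by (metis diff_ge_0_iff_ge of_nat_0_le_iff of_nat_le_iff)
    show "real N - real m \<in> \<nat>" if "m \<le> N"
      using that by (metis of_nat_diff of_nat_in_Nats)
  qed
  have last_rows: "real N - real a \<le> real b \<longleftrightarrow> N \<le> b + a" for a b :: nat
    by linarith
  show ?thesis
    using assms
    by (auto simp: rows_diagram_def regular_diagrams_iff regular_rows_def sorted_rev_map_iff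
        image_subset_iff nat_diff last_rows)
qed

lemma regular_diagramE:
  assumes "D \<in> regular_diagrams N n"
  obtains r where "D = rows_diagram N r"
proof -
  obtain l s where D: "D = Diagram l s" by (cases D)
  with assms have len: "length l = n" "length s = n" and "set s \<subseteq> \<nat>"
    and sum: "\<And>i. i < n \<Longrightarrow> s ! i + l ! i = real N"
    by (auto simp: regular_diagrams_iff)
  then have "\<forall>y\<in>set s. \<exists>m. y = real m" by (auto elim!: Nats_cases)
  then obtain r where s: "s = map real r" by (auto simp flip: ex_map_conv)
  have "l = map (\<lambda>m. real N - real m) r"
    using len sum by (intro nth_equalityI) (auto simp: s eq_diff_eq add.commute)
  then show ?thesis using that by (simp add: D s rows_diagram_def)
qed

lemma regular_diagrams_eq:
  assumes "0 < n"
  shows "regular_diagrams N n = rows_diagram N ` regular_rows N n"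
  using rows_diagram_regular_iff[OF assms] by (blast elim: regular_diagramE)

lemma dominant_weights_iff:
  assumes "0 < n"
  shows "w \<in> dominant_weights n \<longleftrightarrow>
    length w = n \<and> (set w \<subseteq> \<int> \<or> (\<forall>x\<in>set w. x - 1/2 \<in> \<int>)) \<and>
    sorted (rev w) \<and> 0 \<le> w ! (n - 2) + w ! (n - 1)"
proof -
  have "(\<forall>i. i + 2 < n \<longrightarrow> w ! (i + 1) \<le> w ! i) \<and> \<bar>w ! (n - 1)\<bar> \<le> w ! (n - 2) \<longleftrightarrow>
      sorted (rev w) \<and> 0 \<le> w ! (n - 2) + w ! (n - 1)" (is "?dominant \<longleftrightarrow> ?sorted")
    if len: "length w = n"
  proof
    assume dom: ?dominant
    have "w ! Suc i \<le> w ! i" if "Suc i < n" for i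
    proof (cases "i + 2 < n")
      case False
      with that have "i = n - 2" "Suc i = n - 1" by auto
      with dom show ?thesis by auto
    qed (use dom in simp)
    with dom show ?sorted by (auto simp: sorted_rev_iff_nth_Suc len)
  next
    assume sorted: ?sorted
    then have "w ! (n - 1) \<le> w ! (n - 2)"
      using sorted_rev_nth_mono[of w "n - 2" "n - 1"] assms len by simp
    with sorted show ?dominant by (auto simp: sorted_rev_iff_nth_Suc len)
  qed
  moreover have "(\<forall>i<n. w ! i \<in> \<int>) \<or> (\<forall>i<n. w ! i - 1/2 \<in> \<int>) \<longleftrightarrow>
      set w \<subseteq> \<int> \<or> (\<forall>x\<in>set w. x - 1/2 \<in> \<int>)" if "length w = n"
    using that by (simp add: subset_code(1) all_set_conv_all_nth)
  ultimately show ?thesis unfolding dominant_weights_def by blast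
qed

lemma rows_weight_Ints_or_half_Ints:
  "set (rows_weight k r) \<subseteq> \<int> \<or> (\<forall>x\<in>set (rows_weight k r). x - 1/2 \<in> \<int>)"
proof (cases "even k")
  case True
  then obtain c where "k = 2 * c" by blast
  then show ?thesis by (auto simp: rows_weight_def)
next
  case False
  then obtain c where "k = 2 * c + 1" by (rule oddE)
  then have "real m - real k / 2 - 1/2 = of_int (int m - int c - 1)" for m
    by (simp add: field_simps)
  then have "real m - real k / 2 - 1/2 \<in> \<int>" for m by (metis Ints_of_int)
  then show ?thesis by (auto simp: rows_weight_def)
qed

lemma rows_weight_dominant_iff:
  assumes "0 < n" "set r \<subseteq> {..k}"
  shows "rows_weight k r \<in> dominant_weights n \<longleftrightarrow> r \<in> regular_rows k n"
proof -
  have "0 \<le> rows_weight k r ! (n - 2) + rows_weight k r ! (n - 1) \<longleftrightarrow>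
      k \<le> r ! (n - 2) + r ! (n - 1)" if "length r = n"
    using assms(1) that by (simp add: rows_weight_def) linarith
  moreover have "sorted (rev (rows_weight k r)) \<longleftrightarrow> sorted (rev r)"
    unfolding rows_weight_def by (rule sorted_rev_map_iff) simp
  moreover have "length (rows_weight k r) = length r" by (simp add: rows_weight_def)
  ultimately show ?thesis
    using assms rows_weight_Ints_or_half_Ints by (auto simp: dominant_weights_iff regular_rows_def)
qed

lemma regular_rows_truncate:
  assumes "r \<in> regular_rows N n" "k \<le> N" "0 < n"
  shows "map (min k) r \<in> regular_rows k n"
proof -
  have "sorted (rev (map (min k) r))"
    using assms(1) by (auto simp: regular_rows_def sorted_rev_iff_nth_Suc min_le_iff_disj)
  moreover have "k \<le> min k (r ! (n - 2)) + min k (r ! (n - 1))"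
    using assms(1,2) by (auto simp: regular_rows_def)
  ultimately show ?thesis using assms(1,3) by (auto simp: regular_rows_def)
qed

lemma sum_plus_minus_half:
  fixes f :: "'a \<Rightarrow> real"
  assumes "finite A" "\<And>x. x \<in> A \<Longrightarrow> f x = 1/2 \<or> f x = - 1/2"
  shows "sum f A = real (card {x\<in>A. 0 < f x}) - real (card A) / 2"
proof -
  have "sum f A = (\<Sum>x\<in>A. of_bool (0 < f x) - 1/2)"
    using assms(2) by (intro sum.cong) force+
  then show ?thesis using assms(1) by (simp add: sum_subtractf Int_def)
qed

definition path_rows :: "nat \<Rightarrow> weight list \<Rightarrow> nat \<Rightarrow> nat list" where
  "path_rows n \<mu>s k = map (\<lambda>i. card {j\<in>{..<k}. 0 < \<mu>s ! j ! i}) [0..<n]"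

lemma partial_sum_eq_rows_weight:
  assumes "set \<mu>s \<subseteq> spinor_weights n" "k \<le> length \<mu>s"
  shows "partial_sum n \<mu>s k = rows_weight k (path_rows n \<mu>s k)"
proof -
  have "\<mu>s ! j ! i = 1/2 \<or> \<mu>s ! j ! i = - 1/2" if "i < n" "j < k" for i j
  proof -
    have "\<mu>s ! j \<in> spinor_weights n" using assms that by (auto intro: nth_mem)
    then show ?thesis using that(1) by (simp add: spinor_weights_def)
  qed
  then have "(\<Sum>j<k. \<mu>s ! j ! i) = real (card {j\<in>{..<k}. 0 < \<mu>s ! j ! i}) - real k / 2"
    if "i < n" for i
    using that sum_plus_minus_half[of "{..<k}" "\<lambda>j. \<mu>s ! j ! i"] by simp
  then show ?thesis by (simp add: partial_sum_def rows_weight_def path_rows_def)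
qed

lemma set_path_rows_subset: "set (path_rows n \<mu>s k) \<subseteq> {..k}"
proof -
  have "card {j\<in>{..<k}. 0 < \<mu>s ! j ! i} \<le> k" for i
    using card_mono[of "{..<k}" "{j\<in>{..<k}. 0 < \<mu>s ! j ! i}"] by auto
  then show ?thesis by (auto simp: path_rows_def)
qed

lemma dominant_spinor_weight_eq:
  assumes w: "w \<in> spinor_weights n" "w \<in> dominant_weights n" and n: "0 < n"
  shows "w = replicate (n - 1) (1/2) @ [w ! (n - 1)]"
proof (rule nth_equalityI)
  have len: "length w = n" using w(1) by (simp add: spinor_weights_def)
  with n show "length w = length (replicate (n - 1) (1/2) @ [w ! (n - 1)])" by simp
  fix i assume "i < length w"
  then consider (initial) "i < n - 1" | (last) "i = n - 1" using len by linarith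
  then show "w ! i = (replicate (n - 1) (1/2) @ [w ! (n - 1)]) ! i"
  proof cases
    case initial
    have "0 \<le> w ! (n - 2)" using w(2) by (auto simp: dominant_weights_def)
    also have "w ! (n - 2) \<le> w ! i"
      using w(2) n len initial by (intro sorted_rev_nth_mono) (auto simp: dominant_weights_iff)
    finally have "0 \<le> w ! i" .
    moreover have "w ! i = 1/2 \<or> w ! i = - 1/2" using w(1) initial by (simp add: spinor_weights_def)
    ultimately have "w ! i = 1/2" by linarith
    with initial show ?thesis by (simp add: nth_append)
  qed (simp add: nth_append)
qed

text \<open>The condition on the first step is redundant, since that step is the first partial sum.\<close>

lemma spinor_paths_iff:
  assumes "0 < n" "0 < N"
  shows "\<mu>s \<in> spinor_paths n N \<longleftrightarrow> length \<mu>s = N \<and> set \<mu>s \<subseteq> spinor_weights n \<and>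
    (\<forall>k\<in>{1..N}. partial_sum n \<mu>s k \<in> dominant_weights n)" (is "_ \<longleftrightarrow> ?path")
proof
  assume path: ?path
  with assms have first: "\<mu>s ! 0 \<in> spinor_weights n" using nth_mem[of 0 \<mu>s] by auto
  then have "partial_sum n \<mu>s 1 = \<mu>s ! 0"
    by (auto simp: partial_sum_def spinor_weights_def intro: nth_equalityI)
  moreover have "partial_sum n \<mu>s 1 \<in> dominant_weights n" using path assms by simp
  ultimately have "\<mu>s ! 0 = replicate (n - 1) (1/2) @ [\<mu>s ! 0 ! (n - 1)]"
    using dominant_spinor_weight_eq first assms by metis
  moreover have "\<mu>s ! 0 ! (n - 1) = 1/2 \<or> \<mu>s ! 0 ! (n - 1) = - 1/2"
    using first assms by (auto simp: spinor_weights_def)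
  ultimately have "\<mu>s ! 0 = replicate (n - 1) (1/2) @ [1/2] \<or>
      \<mu>s ! 0 = replicate (n - 1) (1/2) @ [- 1/2]" by metis
  with path show "\<mu>s \<in> spinor_paths n N" by (simp add: spinor_paths_def)
qed (simp add: spinor_paths_def)

definition filling_path :: "nat \<Rightarrow> nat list \<Rightarrow> weight list" where
  "filling_path N r = map (\<lambda>j. map (\<lambda>m. if j < m then 1/2 else - 1/2) r) [0..<N]"

lemma filling_path_spinor: "set (filling_path N r) \<subseteq> spinor_weights (length r)"
  by (auto simp: filling_path_def spinor_weights_def split: if_splits)

lemma path_rows_filling_path:
  assumes "k \<le> N"
  shows "path_rows (length r) (filling_path N r) k = map (min k) r"
proof (rule nth_equalityI)
  fix i assume "i < length (path_rows (length r) (filling_path N r) k)"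
  then have i: "i < length r" by (simp add: path_rows_def)
  have "{j\<in>{..<k}. 0 < filling_path N r ! j ! i} = {..<min k (r ! i)}"
    using assms i by (auto simp: filling_path_def split: if_splits)
  then show "path_rows (length r) (filling_path N r) k ! i = map (min k) r ! i"
    using i by (simp add: path_rows_def)
qed (simp add: path_rows_def)

lemma partial_sum_filling_path:
  assumes "k \<le> N"
  shows "partial_sum (length r) (filling_path N r) k = rows_weight k (map (min k) r)"
  using partial_sum_eq_rows_weight[OF filling_path_spinor] path_rows_filling_path[OF assms] assms
  by (simp add: filling_path_def)

lemma filling_path_in_spinor_paths:
  assumes r: "r \<in> regular_rows N n" and "0 < n" "0 < N"
  shows "filling_path N r \<in> spinor_paths n N"
proof -
  have len: "length r = n" using r by (simp add: regular_rows_def)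
  have "partial_sum n (filling_path N r) k \<in> dominant_weights n" if "k \<in> {1..N}" for k
  proof -
    have "map (min k) r \<in> regular_rows k n" using regular_rows_truncate r assms(2) that by simp
    then have "rows_weight k (map (min k) r) \<in> dominant_weights n"
      using assms(2) by (subst rows_weight_dominant_iff) auto
    then show ?thesis using partial_sum_filling_path[of k N r] that len by simp
  qed
  then show ?thesis
    using assms filling_path_spinor[of N r] len by (simp add: spinor_paths_iff filling_path_def)
qed

lemma path_weights_eq:
  assumes "0 < n" "0 < N"
  shows "path_weights n N = rows_weight N ` regular_rows N n"
proof (intro equalityI subsetI)
  fix w assume "w \<in> path_weights n N"
  then obtain \<mu>s where w: "w = partial_sum n \<mu>s N" and path: "\<mu>s \<in> spinor_paths n N"
    by (auto simp: path_weights_def)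
  from path have "w \<in> dominant_weights n" using assms by (simp add: w spinor_paths_iff)
  moreover have "w = rows_weight N (path_rows n \<mu>s N)"
    using path by (simp add: w spinor_paths_def partial_sum_eq_rows_weight)
  ultimately show "w \<in> rows_weight N ` regular_rows N n"
    using rows_weight_dominant_iff[OF assms(1) set_path_rows_subset] by blast
next
  fix w assume "w \<in> rows_weight N ` regular_rows N n"
  then obtain r where w: "w = rows_weight N r" and r: "r \<in> regular_rows N n" by blast
  have "length r = n" using r by (simp add: regular_rows_def)
  moreover have "map (min N) r = r"
    using r by (intro map_idI) (auto simp: regular_rows_def subset_iff)
  ultimately have "w = partial_sum n (filling_path N r) N"
    using partial_sum_filling_path[of N N r] w by simp
  then show "w \<in> path_weights n N"
    using filling_path_in_spinor_paths[OF r assms] by (auto simp: path_weights_def)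
qed

theorem proposition4p7:
  fixes n N :: nat
  assumes "n \<ge> 2" and "N \<ge> 1"
  shows "bij_betw (weight_diagram N) (path_weights n N) (regular_diagrams N n)"
proof (rule bij_betw_imageI)
  show "inj_on (weight_diagram N) (path_weights n N)"
    using inj_weight_diagram by (rule inj_on_subset) simp
  have "weight_diagram N ` path_weights n N = rows_diagram N ` regular_rows N n"
    using assms by (simp add: path_weights_eq image_image weight_diagram_rows_weight)
  also have "\<dots> = regular_diagrams N n"
    using assms by (simp add: regular_diagrams_eq)
  finally show "weight_diagram N ` path_weights n N = regular_diagrams N n" .
qed

end
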